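(* Let $X$ be a normed space, let $F\subseteq X$ be a nonempty closed convex set, and let $Q\subseteq X$ be a nonempty convex set. Then the minimal time function $\mathcal{T}^F_Q: X\to[0,\infty]$ is convex.
   Context: Normed spaces are real. For $t\ge 0$, $tF=\{tf: f\in F\}$ (so $0F=\{0\}$), and $\inf\emptyset=\infty$. The minimal time function is $\mathcal{T}^F_Q(x)=\inf\{t\ge 0: (x+tF)\cap Q\ne\emptyset\}\in[0,\infty]$. Convexity of an extended-real-valued function $\varphi:X\to(-\infty,\infty]$ means $\varphi(\lambda x_1+(1-\lambda)x_2)\le\lambda\varphi(x_1)+(1-\lambda)\varphi(x_2)$ for all $x_1,x_2\in X$ and $\lambda\in(0,1)$. *)

theory Defs
  imports "HOL-Analysis.Analysis"
begin

(* The type ereal includes -\<infinity>, which is not an admissible value, hence the first conjunct.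
   Since 0 < l < 1, no product 0 * \<infinity> occurs and no sum \<infinity> + (-\<infinity>) arises. *)
definition ext_convex :: "('a::real_vector \<Rightarrow> ereal) \<Rightarrow> bool" where
  "ext_convex \<phi> \<longleftrightarrow>
     (\<forall>x. \<phi> x \<noteq> -\<infinity>) \<and>
     (\<forall>x1 x2. \<forall>l::real. 0 < l \<and> l < 1 \<longrightarrow>
        \<phi> (l *\<^sub>R x1 + (1 - l) *\<^sub>R x2) \<le> ereal l * \<phi> x1 + ereal (1 - l) * \<phi> x2)"

(* The infimum is taken in ereal, so it is \<infinity> when no t is admissible. *)
definition minimal_time :: "'a::real_vector set \<Rightarrow> 'a set \<Rightarrow> 'a \<Rightarrow> ereal" where
  "minimal_time F Q x =
     Inf (ereal ` {t. 0 \<le> t \<and> (+) x ` ((*\<^sub>R) t ` F) \<inter> Q \<noteq> {}})"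

lemma minimal_time_nonneg: "0 \<le> minimal_time F Q x"
  unfolding minimal_time_def by (rule Inf_greatest) auto

lemma minimal_time_eq_infinity:
  assumes "\<And>t. 0 \<le> t \<Longrightarrow> (+) x ` ((*\<^sub>R) t ` F) \<inter> Q = {}"
  shows "minimal_time F Q x = \<infinity>"
proof -
  have "{t. 0 \<le> t \<and> (+) x ` ((*\<^sub>R) t ` F) \<inter> Q \<noteq> {}} = {}"
    using assms by blast
  then show ?thesis
    unfolding minimal_time_def by (simp only: image_empty Inf_empty top_ereal_def)
qed

end

theory Submission
  imports Defs
begin

text \<open>If \<open>x\<^sub>1 + t\<^sub>1 f\<^sub>1\<close> and \<open>x\<^sub>2 + t\<^sub>2 f\<^sub>2\<close> lie in \<open>Q\<close>, then so does their convex combination,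
  and \<open>l t\<^sub>1 f\<^sub>1 + (1 - l) t\<^sub>2 f\<^sub>2 = s f\<close> with \<open>s = l t\<^sub>1 + (1 - l) t\<^sub>2\<close> and some \<open>f \<in> F\<close>, because \<open>F\<close>
  is convex. Hence \<open>s\<close> is an admissible time at the convex combination of \<open>x\<^sub>1\<close> and \<open>x\<^sub>2\<close>;
  now take near-optimal times \<open>t\<^sub>1\<close> and \<open>t\<^sub>2\<close>.\<close>

text \<open>Dividing by \<open>a + b\<close> turns the coefficients into convex weights. If
  \<open>a + b = 0\<close>, both coefficients vanish and any point of \<open>F\<close> serves as
  \<open>h\<close>.\<close>

lemma convex_combine_scaled:
  fixes F :: "'a::real_vector set"
  assumes "convex F" "f \<in> F" "g \<in> F" "0 \<le> a" "0 \<le> b"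
  obtains h where "h \<in> F" "a *\<^sub>R f + b *\<^sub>R g = (a + b) *\<^sub>R h"
proof (cases "a + b = 0")
  case True
  then have "a = 0" "b = 0" using assms(4,5) by auto
  then show ?thesis using that[of f] assms(2) by simp
next
  case False
  let ?h = "(a / (a + b)) *\<^sub>R f + (b / (a + b)) *\<^sub>R g"
  have "?h \<in> F"
    using assms False by (intro convexD) (auto simp: add_divide_distrib[symmetric])
  moreover have "a *\<^sub>R f + b *\<^sub>R g = (a + b) *\<^sub>R ?h"
    using False by (simp add: scaleR_right_distrib)
  ultimately show ?thesis using that by blast
qed

lemma minimal_time_le:
  assumes "0 \<le> t" "f \<in> F" "x + t *\<^sub>R f \<in> Q"
  shows "minimal_time F Q x \<le> ereal t"
  unfolding minimal_time_def using assms by (intro Inf_lower) blast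

text \<open>The infimum may fail to be attained, so admissible times are extracted from a strict
  upper bound.\<close>

lemma minimal_time_lessE:
  assumes "minimal_time F Q x < c"
  obtains t f where "0 \<le> t" "f \<in> F" "x + t *\<^sub>R f \<in> Q" "ereal t < c"
  using assms unfolding minimal_time_def Inf_less_iff by blast

lemma minimal_time_convex_combination_le:
  fixes F Q :: "'a::real_vector set"
  assumes "convex F" "convex Q" and l: "0 \<le> l" "l \<le> 1"
    and 1: "0 \<le> t1" "f1 \<in> F" "x1 + t1 *\<^sub>R f1 \<in> Q"
    and 2: "0 \<le> t2" "f2 \<in> F" "x2 + t2 *\<^sub>R f2 \<in> Q"
  shows "minimal_time F Q (l *\<^sub>R x1 + (1 - l) *\<^sub>R x2) \<le> ereal (l * t1 + (1 - l) * t2)"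
proof -
  have nn: "0 \<le> l * t1" "0 \<le> (1 - l) * t2" using l 1 2 by auto
  obtain h where h: "h \<in> F"
    "(l * t1) *\<^sub>R f1 + ((1 - l) * t2) *\<^sub>R f2 = (l * t1 + (1 - l) * t2) *\<^sub>R h"
    using convex_combine_scaled[OF \<open>convex F\<close> 1(2) 2(2) nn] .
  have "l *\<^sub>R (x1 + t1 *\<^sub>R f1) + (1 - l) *\<^sub>R (x2 + t2 *\<^sub>R f2) \<in> Q"
    using \<open>convex Q\<close> 1(3) 2(3) l by (intro convexD) auto
  also have "l *\<^sub>R (x1 + t1 *\<^sub>R f1) + (1 - l) *\<^sub>R (x2 + t2 *\<^sub>R f2)
      = l *\<^sub>R x1 + (1 - l) *\<^sub>R x2 + (l * t1 + (1 - l) * t2) *\<^sub>R h"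
    unfolding h(2)[symmetric] scaleR_right_distrib scaleR_scaleR by (simp only: ac_simps)
  finally show ?thesis
    using nn h(1) by (intro minimal_time_le) auto
qed

theorem theorem3p3:
  fixes F Q :: "'a::real_normed_vector set"
  assumes "F \<noteq> {}" and "closed F" and "convex F"
    and "Q \<noteq> {}" and "convex Q"
  shows "ext_convex (minimal_time F Q)"
  unfolding ext_convex_def
proof (intro conjI allI impI)
  fix x
  show "minimal_time F Q x \<noteq> -\<infinity>"
    using minimal_time_nonneg[of F Q x] by auto
next
  fix x1 x2 :: 'a and l :: real
  assume l: "0 < l \<and> l < 1"
  let ?T = "minimal_time F Q"
  show "?T (l *\<^sub>R x1 + (1 - l) *\<^sub>R x2) \<le> ereal l * ?T x1 + ereal (1 - l) * ?T x2"
  proof (cases "?T x1 = \<infinity> \<or> ?T x2 = \<infinity>")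
    case True
    \<comment> \<open>Both weights are strictly positive, so an infinite value stays infinite, and
      nonnegativity of the other term excludes cancellation.\<close>
    then have "ereal l * ?T x1 + ereal (1 - l) * ?T x2 = \<infinity>"
      using l minimal_time_nonneg[of F Q x1] minimal_time_nonneg[of F Q x2]
      by (cases "?T x1"; cases "?T x2") auto
    then show ?thesis by (simp only: ereal_less_eq(1))
  next
    case False
    then obtain r1 r2 where r: "?T x1 = ereal r1" "?T x2 = ereal r2"
      using minimal_time_nonneg[of F Q x1] minimal_time_nonneg[of F Q x2]
      by (cases "?T x1"; cases "?T x2") auto
    \<comment> \<open>The same slack \<open>e\<close> is allowed at both points: since the weights
      sum to 1, the total error is exactly \<open>e\<close>, which is arbitrary.\<close>
    have "?T (l *\<^sub>R x1 + (1 - l) *\<^sub>R x2) \<le> ereal (l * r1 + (1 - l) * r2) + ereal e"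
      if "0 < e" for e
    proof -
      have "?T x1 < ereal (r1 + e)" using r(1) \<open>0 < e\<close> by simp
      then obtain t1 f1 where 1: "0 \<le> t1" "f1 \<in> F" "x1 + t1 *\<^sub>R f1 \<in> Q" "ereal t1 < ereal (r1 + e)"
        by (rule minimal_time_lessE)
      have "?T x2 < ereal (r2 + e)" using r(2) \<open>0 < e\<close> by simp
      then obtain t2 f2 where 2: "0 \<le> t2" "f2 \<in> F" "x2 + t2 *\<^sub>R f2 \<in> Q" "ereal t2 < ereal (r2 + e)"
        by (rule minimal_time_lessE)
      have "?T (l *\<^sub>R x1 + (1 - l) *\<^sub>R x2) \<le> ereal (l * t1 + (1 - l) * t2)"
        using minimal_time_convex_combination_le[OF assms(3,5) _ _ 1(1-3) 2(1-3)] l by simp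
      also have "\<dots> \<le> ereal (l * (r1 + e) + (1 - l) * (r2 + e))"
        unfolding ereal_less_eq using 1(4) 2(4) l by (intro add_mono mult_left_mono) auto
      also have "\<dots> = ereal (l * r1 + (1 - l) * r2) + ereal e"
        by (simp add: algebra_simps)
      finally show ?thesis .
    qed
    then have "?T (l *\<^sub>R x1 + (1 - l) *\<^sub>R x2) \<le> ereal (l * r1 + (1 - l) * r2)"
      by - (rule ereal_le_epsilon2, blast)
    then show ?thesis
      unfolding r times_ereal.simps plus_ereal.simps .
  qed
qed

end
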